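(* Let $m,n$ be natural numbers (positive integers) with $m\ne 1$ and $n\neq 1$, and let $K_{m,n}$ be the complete bipartite graph with parts of sizes $m$ and $n$. Then: (i) the elliptic Sombor characteristic polynomial of $K_{m,n}$ is $$\phi_{ESO}(K_{m,n},\lambda)=\lambda^{m+n-2}\left(\lambda^2-mn(m^2+n^2)(m+n)^2\right);$$ (ii) the elliptic Sombor energy of $K_{m,n}$ is $$E_{ESO}(K_{m,n})=2(m+n)\sqrt{mn(m^2+n^2)}.$$
   Context: For a simple graph $G$ with vertex set $\{v_1,\ldots,v_N\}$, let $d_i$ denote the degree of $v_i$. The elliptic Sombor matrix $A_{ESO}(G)$ is the $N\times N$ real symmetric matrix whose $(i,j)$-entry is $(d_i+d_j)\sqrt{d_i^2+d_j^2}$ if $v_i$ and $v_j$ are adjacent, and $0$ otherwise. The elliptic Sombor characteristic polynomial is $\phi_{ESO}(G,\lambda)=\det(\lambda I-A_{ESO}(G))$, and the elliptic Sombor energy is $E_{ESO}(G)=\sum_{i=1}^N|\lambda_i|$, where $\lambda_1,\ldots,\lambda_N$ are the eigenvalues of $A_{ESO}(G)$ counted with multiplicity. *)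

theory Defs
  imports
    Complex_Main
    "Graph_Theory.Graph_Theory"
    "Jordan_Normal_Form.Char_Poly"
begin

text \<open>
  Simple graphs are the locale \<^locale>\<open>graph\<close> (finite, loop-free, symmetric digraphs without
  multiple arcs), so an undirected edge is a pair of opposite arcs and the degree of a vertex
  is its out-degree. The list \<open>vs\<close> is the numbering of the vertices; it is meant to be distinct
  with \<open>set vs = verts G\<close>.
\<close>

definition eso_matrix :: "('a, 'b) pre_digraph \<Rightarrow> 'a list \<Rightarrow> real mat" where
  "eso_matrix G vs = mat (length vs) (length vs) (\<lambda>(i, j).
     if vs ! i \<rightarrow>\<^bsub>G\<^esub> vs ! j
     then (real (out_degree G (vs ! i)) + real (out_degree G (vs ! j)))
          * sqrt ((real (out_degree G (vs ! i)))\<^sup>2 + (real (out_degree G (vs ! j)))\<^sup>2)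
     else 0)"

definition eso_char_poly :: "('a, 'b) pre_digraph \<Rightarrow> 'a list \<Rightarrow> real poly" where
  "eso_char_poly G vs = char_poly (eso_matrix G vs)"

text \<open>
  The matrix is real symmetric, so its spectrum is real; the multiplicity of an eigenvalue is
  its order as a root of the characteristic polynomial.
\<close>

definition eso_energy :: "('a, 'b) pre_digraph \<Rightarrow> 'a list \<Rightarrow> real" where
  "eso_energy G vs =
     (\<Sum>x | eigenvalue (eso_matrix G vs) x. real (order x (eso_char_poly G vs)) * \<bar>x\<bar>)"

end

theory Submission
  imports Defs
begin

text \<open>
  Every vertex of \<open>K\<^bsub>m,n\<^esub>\<close> has degree \<open>n\<close> or \<open>m\<close> according to its part, and every edge joins the two
  parts. So all nonzero entries of the elliptic Sombor matrix are equal to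
  \<open>c = (m + n) * sqrt (m\<^sup>2 + n\<^sup>2)\<close>, and the matrix is \<open>c\<close> times the adjacency matrix. With \<open>u\<close> and \<open>v\<close>
  the indicator vectors of the two parts, it is \<open>c * (u v\<^sup>T + v u\<^sup>T)\<close>, a product \<open>X * Y\<close> in which \<open>X\<close> has
  only two columns. This description does not depend on how the vertices are numbered, so they
  need not be sorted into two blocks.

  The products \<open>X * Y\<close> and \<open>Y * X\<close> have the same characteristic polynomial up to a power of the
  variable (\<open>char_poly_mult_commute\<close>). Here \<open>Y * X\<close> is a 2 by 2 matrix with zero diagonal, since
  the parts are disjoint, and its two other entries are \<open>c\<close> times the sizes of the parts. Its
  characteristic polynomial is therefore the variable squared minus \<open>m * n * c\<^sup>2\<close>, which gives the first
  claim (\<open>char_poly_bipartite_constant\<close>).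

  The nonzero roots are then \<open>s\<close> and \<open>- s\<close> with \<open>s = c * sqrt (m * n)\<close>, both simple, and the root \<open>0\<close>
  contributes nothing whatever its multiplicity, so the energy is \<open>2 * s\<close>
  (\<open>sum_order_abs_roots\<close>).
\<close>

section \<open>Characteristic polynomials of \<open>X * Y\<close> and \<open>Y * X\<close>\<close>

lemma four_block_mat_cong:
  "A = A' \<Longrightarrow> B = B' \<Longrightarrow> C = C' \<Longrightarrow> D = D' \<Longrightarrow>
    four_block_mat A B C D = four_block_mat A' B' C' D'"
  by simp

lemma det_2_by_2:
  fixes A :: "'a :: comm_ring_1 mat"
  assumes "A \<in> carrier_mat 2 2"
  shows "det A = A $$ (0, 0) * A $$ (1, 1) - A $$ (0, 1) * A $$ (1, 0)"
proof -
  have "det A = (\<Sum>j<2. A $$ (0, j) * cofactor A 0 j)"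
    by (rule laplace_expansion_row[OF assms]) simp
  moreover have "det (mat_delete A 0 j) = mat_delete A 0 j $$ (0, 0)" for j
    using mat_delete_carrier[OF assms, of 0 j] by (intro det_single) simp
  ultimately show ?thesis
    using assms by (simp add: cofactor_def numeral_2_eq_2) (simp add: mat_delete_def)
qed

text \<open>
  Sylvester's determinant identity, in a form free of division. Both determinants come from one
  matrix with blocks \<open>t \<cdot>\<^sub>m 1\<^sub>m n\<close>, \<open>X\<close>, \<open>Y\<close>, \<open>1\<^sub>m k\<close>: one block row operation clears \<open>X\<close>, another one
  clears \<open>Y\<close>. The second must first scale the lower rows by \<open>t\<close>, which is where \<open>t ^ k\<close> comes from.
\<close>

lemma power_times_det_minus_mult_commute:
  fixes X Y :: "'a :: idom mat" and t :: 'a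
  assumes X: "X \<in> carrier_mat n k" and Y: "Y \<in> carrier_mat k n"
  shows "t ^ k * det (t \<cdot>\<^sub>m 1\<^sub>m n - X * Y) = t ^ n * det (t \<cdot>\<^sub>m 1\<^sub>m k - Y * X)"
proof -
  define M where "M = four_block_mat (t \<cdot>\<^sub>m 1\<^sub>m n) X Y (1\<^sub>m k)"
  define L where "L = four_block_mat (1\<^sub>m n) (- X) (0\<^sub>m k n) (1\<^sub>m k)"
  define R where "R = four_block_mat (1\<^sub>m n) (0\<^sub>m n k) (- Y) (t \<cdot>\<^sub>m 1\<^sub>m k)"
  have carrier: "M \<in> carrier_mat (n + k) (n + k)" "L \<in> carrier_mat (n + k) (n + k)"
      "R \<in> carrier_mat (n + k) (n + k)"
    unfolding M_def L_def R_def by simp_all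
  have XY: "X * Y \<in> carrier_mat n n" and YX: "Y * X \<in> carrier_mat k k"
    using X Y by auto
  have "L * M = four_block_mat (1\<^sub>m n * (t \<cdot>\<^sub>m 1\<^sub>m n) + (- X) * Y) (1\<^sub>m n * X + (- X) * 1\<^sub>m k)
      (0\<^sub>m k n * (t \<cdot>\<^sub>m 1\<^sub>m n) + 1\<^sub>m k * Y) (0\<^sub>m k n * X + 1\<^sub>m k * 1\<^sub>m k)"
    unfolding L_def M_def by (rule mult_four_block_mat) (use X Y in auto)
  also have "\<dots> = four_block_mat (t \<cdot>\<^sub>m 1\<^sub>m n - X * Y) (0\<^sub>m n k) Y (1\<^sub>m k)"
  proof (rule four_block_mat_cong)
    show "1\<^sub>m n * (t \<cdot>\<^sub>m 1\<^sub>m n) + (- X) * Y = t \<cdot>\<^sub>m 1\<^sub>m n - X * Y"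
      using X Y XY by (auto simp: minus_add_uminus_mat)
    show "1\<^sub>m n * X + (- X) * 1\<^sub>m k = 0\<^sub>m n k"
      using X by auto
    show "0\<^sub>m k n * (t \<cdot>\<^sub>m 1\<^sub>m n) + 1\<^sub>m k * Y = Y" using Y by auto
    show "0\<^sub>m k n * X + 1\<^sub>m k * 1\<^sub>m k = 1\<^sub>m k" using X by auto
  qed
  finally have LM: "det (L * M) = det (t \<cdot>\<^sub>m 1\<^sub>m n - X * Y)"
    using Y XY det_four_block_mat_upper_right_zero[of "t \<cdot>\<^sub>m 1\<^sub>m n - X * Y" n "0\<^sub>m n k" k Y "1\<^sub>m k"]
    by (simp add: minus_carrier_mat)
  have "R * M = four_block_mat (1\<^sub>m n * (t \<cdot>\<^sub>m 1\<^sub>m n) + 0\<^sub>m n k * Y) (1\<^sub>m n * X + 0\<^sub>m n k * 1\<^sub>m k)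
      ((- Y) * (t \<cdot>\<^sub>m 1\<^sub>m n) + (t \<cdot>\<^sub>m 1\<^sub>m k) * Y) ((- Y) * X + (t \<cdot>\<^sub>m 1\<^sub>m k) * 1\<^sub>m k)"
    unfolding R_def M_def by (rule mult_four_block_mat) (use X Y in auto)
  also have "\<dots> = four_block_mat (t \<cdot>\<^sub>m 1\<^sub>m n) X (0\<^sub>m k n) (t \<cdot>\<^sub>m 1\<^sub>m k - Y * X)"
  proof (rule four_block_mat_cong)
    show "1\<^sub>m n * (t \<cdot>\<^sub>m 1\<^sub>m n) + 0\<^sub>m n k * Y = t \<cdot>\<^sub>m 1\<^sub>m n" using Y by auto
    show "1\<^sub>m n * X + 0\<^sub>m n k * 1\<^sub>m k = X" using X by auto
    have "(- Y) * (t \<cdot>\<^sub>m 1\<^sub>m n) = t \<cdot>\<^sub>m (- Y)"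
      using Y by (simp add: mult_smult_distrib[of _ k n _ n])
    moreover have "(t \<cdot>\<^sub>m 1\<^sub>m k) * Y = t \<cdot>\<^sub>m Y"
      using Y by (simp add: mult_smult_assoc_mat[of _ k k _ n])
    ultimately show "(- Y) * (t \<cdot>\<^sub>m 1\<^sub>m n) + (t \<cdot>\<^sub>m 1\<^sub>m k) * Y = 0\<^sub>m k n"
      using Y by (intro eq_matI) auto
    have "(- Y) * X = - (Y * X)" using X Y by auto
    moreover have "(t \<cdot>\<^sub>m 1\<^sub>m k) * 1\<^sub>m k = t \<cdot>\<^sub>m 1\<^sub>m k" by simp
    ultimately show "(- Y) * X + (t \<cdot>\<^sub>m 1\<^sub>m k) * 1\<^sub>m k = t \<cdot>\<^sub>m 1\<^sub>m k - Y * X"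
      using X Y YX by (intro eq_matI) auto
  qed
  finally have RM: "det (R * M) = t ^ n * det (t \<cdot>\<^sub>m 1\<^sub>m k - Y * X)"
    using X YX
      det_four_block_mat_lower_left_zero[of "t \<cdot>\<^sub>m 1\<^sub>m n" n X k "0\<^sub>m k n" "t \<cdot>\<^sub>m 1\<^sub>m k - Y * X"]
    by (simp add: minus_carrier_mat)
  have "det L = 1"
    unfolding L_def using X by (subst det_four_block_mat_lower_left_zero[of _ n _ k]) auto
  then have "det M = det (t \<cdot>\<^sub>m 1\<^sub>m n - X * Y)"
    using LM carrier by (simp add: det_mult[of _ "n + k"])
  moreover have "det R = t ^ k"
    unfolding R_def using Y by (subst det_four_block_mat_upper_right_zero[of _ n _ k]) auto
  then have "t ^ k * det M = t ^ n * det (t \<cdot>\<^sub>m 1\<^sub>m k - Y * X)"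
    using RM carrier by (simp add: det_mult[of _ "n + k"])
  ultimately show ?thesis by simp
qed

text \<open>
  The previous identity over the polynomial ring, with the variable for \<open>t\<close> and the entries of \<open>X\<close>
  and \<open>Y\<close> read as constant polynomials.
\<close>

lemma char_poly_mult_commute:
  fixes X Y :: "'a :: idom mat"
  assumes X: "X \<in> carrier_mat n k" and Y: "Y \<in> carrier_mat k n"
  shows "[:0, 1:] ^ k * char_poly (X * Y) = [:0, 1:] ^ n * char_poly (Y * X)"
proof -
  let ?c = "map_mat (\<lambda>a. [:a:]) :: 'a mat \<Rightarrow> 'a poly mat"
  have "char_poly_matrix (X * Y) = [:0, 1:] \<cdot>\<^sub>m 1\<^sub>m n - ?c X * ?c Y"
    unfolding char_poly_matrix_def map_poly_mult(1)[OF X Y, symmetric]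
    using X Y by (intro eq_matI) auto
  moreover have "char_poly_matrix (Y * X) = [:0, 1:] \<cdot>\<^sub>m 1\<^sub>m k - ?c Y * ?c X"
    unfolding char_poly_matrix_def map_poly_mult(1)[OF Y X, symmetric]
    using X Y by (intro eq_matI) auto
  moreover have "?c X \<in> carrier_mat n k" "?c Y \<in> carrier_mat k n"
    using X Y by auto
  ultimately show ?thesis
    unfolding char_poly_def by (simp add: power_times_det_minus_mult_commute)
qed

section \<open>Weighted complete bipartite matrices\<close>

text \<open>
  The matrix has rank at most two: it is a product of an \<open>N\<close> by 2 and a 2 by \<open>N\<close> matrix made of the
  indicators of \<open>P\<close> and \<open>Q\<close>, so the computation moves to a 2 by 2 matrix. That both parts are
  inhabited is what makes the truncated exponent \<open>N - 2\<close> correct.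
\<close>

lemma char_poly_bipartite_constant:
  fixes c :: "'a :: idom"
  assumes P: "P \<subseteq> {..<N}" and Q: "Q = {..<N} - P" and ne: "card P > 0" "card Q > 0"
  shows "char_poly (mat N N (\<lambda>(i, j). if (i \<in> P) \<noteq> (j \<in> P) then c else 0)) =
    [:0, 1:] ^ (N - 2) * ([:0, 1:]\<^sup>2 - [:of_nat (card P) * of_nat (card Q) * c\<^sup>2:])"
    (is "char_poly ?A = ?rhs")
proof -
  \<comment> \<open>The columns of \<open>X\<close> are \<open>c\<close> times the indicators of \<open>P\<close> and \<open>Q\<close>, in this order; the rows of \<open>Y\<close>
    are the indicators of \<open>Q\<close> and \<open>P\<close>, in the opposite order.\<close>
  define X where "X = mat N 2 (\<lambda>(i, j). if (i \<in> P) = (j = 0) then c else 0)"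
  define Y where "Y = mat 2 N (\<lambda>(i, j). if (j \<in> P) = (i = 0) then 0 else 1 :: 'a)"
  have X: "X \<in> carrier_mat N 2" and Y: "Y \<in> carrier_mat 2 N"
    by (auto simp: X_def Y_def)
  have A: "?A = X * Y"
    by (intro eq_matI) (auto simp: X_def Y_def scalar_prod_def numeral_2_eq_2)
  have PQ: "{0..<N} \<inter> P = P" "{0..<N} \<inter> - P = Q" "{0..<N} \<inter> {x. x \<notin> P} = Q"
    using P Q by auto
  have entries: "(Y * X) $$ (i, j) =
      (if i = j then 0 else if i = 0 then of_nat (card Q) * c else of_nat (card P) * c)"
    if "i < 2" "j < 2" for i j
  proof -
    have "(Y * X) $$ (i, j) = (\<Sum>l\<in>{0..<N}. (if (l \<in> P) = (i = 0) then 0 else 1) *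
        (if (l \<in> P) = (j = 0) then c else 0))"
      using that by (simp add: X_def Y_def scalar_prod_def)
    also have "\<dots> = (\<Sum>l\<in>{0..<N}. if i = j then 0 else if (l \<in> P) = (i \<noteq> 0) then c else 0)"
    proof (rule sum.cong[OF refl])
      fix l
      consider "i = 0" "j = 0" | "i = 0" "j = 1" | "i = 1" "j = 0" | "i = 1" "j = 1"
        using \<open>i < 2\<close> \<open>j < 2\<close> by linarith
      then show "(if (l \<in> P) = (i = 0) then 0 else 1) * (if (l \<in> P) = (j = 0) then c else 0) =
          (if i = j then 0 else if (l \<in> P) = (i \<noteq> 0) then c else 0)"
        by cases simp_all
    qed
    also have "\<dots> =
      (if i = j then 0 else if i = 0 then of_nat (card Q) * c else of_nat (card P) * c)"
      by (simp add: PQ sum.If_cases)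
    finally show ?thesis .
  qed
  have "char_poly (Y * X) = [:0, 1:]\<^sup>2 - [:of_nat (card P) * of_nat (card Q) * c\<^sup>2:]"
  proof -
    have cm: "char_poly_matrix (Y * X) \<in> carrier_mat 2 2"
      using X Y by (intro char_poly_matrix_closed) auto
    have "char_poly (Y * X) = char_poly_matrix (Y * X) $$ (0, 0) * char_poly_matrix (Y * X) $$ (1, 1)
        - char_poly_matrix (Y * X) $$ (0, 1) * char_poly_matrix (Y * X) $$ (1, 0)"
      unfolding char_poly_def by (rule det_2_by_2[OF cm])
    then show ?thesis
      using X Y by (simp add: char_poly_matrix_def entries del: index_mult_mat(1))
        (simp add: power2_eq_square algebra_simps)
  qed
  then have "[:0, 1:]\<^sup>2 * char_poly ?A = [:0, 1:] ^ N *
      ([:0, 1:]\<^sup>2 - [:of_nat (card P) * of_nat (card Q) * c\<^sup>2:])"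
    unfolding A using char_poly_mult_commute[OF X Y] by simp
  moreover have "card P + card Q = N"
    using P Q by (simp add: card_Diff_subset finite_subset card_mono[of "{..<N}", simplified])
  then have "N = 2 + (N - 2)" using ne by simp
  then have "([:0, 1:] :: 'a poly) ^ N = [:0, 1:]\<^sup>2 * [:0, 1:] ^ (N - 2)"
    by (metis power_add)
  ultimately have "[:0, 1:]\<^sup>2 * char_poly ?A = [:0, 1:]\<^sup>2 * ?rhs"
    by (simp only: mult.assoc)
  then show ?thesis by simp
qed

section \<open>The energy read off the characteristic polynomial\<close>

text \<open>
  The factor \<open>[:0, 1:] ^ k\<close> only affects the order of \<open>0\<close>, which is weighted by \<open>\<bar>0\<bar>\<close>. The other factor
  splits into the linear factors of \<open>s\<close> and \<open>- s\<close>, which are distinct, so each of these roots counts once.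
\<close>

lemma sum_order_abs_roots:
  fixes s :: real
  assumes s: "s > 0" and p: "p = [:0, 1:] ^ k * ([:0, 1:]\<^sup>2 - [:s\<^sup>2:])"
  shows "(\<Sum>x | poly p x = 0. real (order x p) * \<bar>x\<bar>) = 2 * s"
proof -
  \<comment> \<open>The root \<open>- s\<close> is written with a double negation so that both factors have the shape \<open>[:- a, 1:]\<close>.\<close>
  have fact: "p = [:0, 1:] ^ k * ([:-s, 1:] * [:-(-s), 1:])"
    unfolding p by (simp add: power2_eq_square)
  have p0: "p \<noteq> 0" unfolding fact by (simp only: mult_eq_0_iff power_eq_0_iff) simp
  have order_linear: "order x [:- a, 1:] = (if x = a then 1 else 0)" for x a :: real
    using order_power_n_n[of a 1] by (auto intro: order_0I)
  have order_power: "order x ([:0, 1:] ^ k) = 0" if "x \<noteq> 0" for x :: real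
    using that by (intro order_0I) simp
  have order_nz: "order x p = (if x = s then 1 else 0) + (if x = - s then 1 else 0)"
    if "x \<noteq> 0" for x
  proof -
    have "order x p = order x ([:0, 1:] ^ k) + order x ([:-s, 1:] * [:-(-s), 1:])"
      using p0 unfolding fact by (rule order_mult)
    also have "order x ([:-s, 1:] * [:-(-s), 1:]) = order x [:-s, 1:] + order x [:-(-s), 1:]"
      by (rule order_mult, simp only: mult_eq_0_iff, simp)
    finally show ?thesis by (simp only: order_linear order_power[OF that])
  qed
  have "(\<Sum>x | poly p x = 0. real (order x p) * \<bar>x\<bar>) = (\<Sum>x\<in>{s, - s}. real (order x p) * \<bar>x\<bar>)"
  proof (rule sum.mono_neutral_right)
    show "finite {x. poly p x = 0}" by (rule poly_roots_finite[OF p0])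
    show "{s, - s} \<subseteq> {x. poly p x = 0}" by (auto simp: fact)
    show "\<forall>x\<in>{x. poly p x = 0} - {s, - s}. real (order x p) * \<bar>x\<bar> = 0"
    proof
      fix x assume "x \<in> {x. poly p x = 0} - {s, - s}"
      then show "real (order x p) * \<bar>x\<bar> = 0"
        by (cases "x = 0") (simp_all add: order_nz)
    qed
  qed
  also have "\<dots> = 2 * s"
    using s by (simp add: order_nz)
  finally show ?thesis .
qed

section \<open>Complete bipartite graphs\<close>

lemma (in nomulti_digraph) out_degree_eq_card_dominated:
  "out_degree G v = card {w. v \<rightarrow>\<^bsub>G\<^esub> w}"
proof -
  have "{w. v \<rightarrow>\<^bsub>G\<^esub> w} = head G ` out_arcs G v"
    by (auto simp: arcs_ends_conv)
  moreover have "inj_on (head G) (out_arcs G v)"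
    by (auto intro!: inj_onI no_multi_arcs simp: arc_to_ends_def)
  ultimately show ?thesis
    by (simp add: out_degree_def card_image)
qed

lemma card_index_distinct:
  assumes "distinct xs" "S \<subseteq> set xs"
  shows "card {i. i < length xs \<and> xs ! i \<in> S} = card S"
proof -
  let ?I = "{i. i < length xs \<and> xs ! i \<in> S}"
  have "(!) xs ` ?I = S"
    using assms(2) by (auto simp: in_set_conv_nth image_iff) (metis in_set_conv_nth subsetD)
  moreover have "inj_on ((!) xs) ?I"
    using assms(1) by (intro inj_on_nth) auto
  ultimately show ?thesis using card_image by metis
qed

theorem theorem2p5:
  fixes G :: "('a, 'b) pre_digraph" and vs :: "'a list" and m n :: nat
  assumes "m > 0" and "n > 0" and "m \<noteq> 1" and "n \<noteq> 1"
    and "complete_bipartite_digraph m n G"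
    and "distinct vs" and "set vs = verts G"
  shows "eso_char_poly G vs =
           [:0, 1:] ^ (m + n - 2) *
           ([:0, 1:]\<^sup>2 - [:real m * real n * ((real m)\<^sup>2 + (real n)\<^sup>2) * (real m + real n)\<^sup>2:])
         \<and> eso_energy G vs =
           2 * (real m + real n) * sqrt (real m * real n * ((real m)\<^sup>2 + (real n)\<^sup>2))"
proof -
  from assms(5) obtain U V where "graph G" and UV: "verts G = U \<union> V" "U \<inter> V = {}"
    and card: "card U = m" "card V = n" and ends: "arcs_ends G = U \<times> V \<union> V \<times> U"
    unfolding complete_bipartite_digraph_def by blast
  then interpret graph G by simp
  define N where "N = length vs"
  define P where "P = {i. i < N \<and> vs ! i \<in> U}"
  define Q where "Q = {..<N} - P"
  define c where "c = (real m + real n) * sqrt ((real m)\<^sup>2 + (real n)\<^sup>2)"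
  \<comment> \<open>This is \<open>c * sqrt (m * n)\<close>, the positive eigenvalue.\<close>
  define s where "s = (real m + real n) * sqrt (real m * real n * ((real m)\<^sup>2 + (real n)\<^sup>2))"
  have vs: "vs ! i \<in> U \<union> V" if "i < N" for i
    using that assms(7) UV by (metis N_def nth_mem)
  have cP: "card P = m"
    unfolding P_def N_def using assms(6,7) UV card by (subst card_index_distinct) auto
  have "Q = {i. i < N \<and> vs ! i \<in> V}"
    unfolding Q_def P_def using vs UV by auto
  then have cQ: "card Q = n"
    unfolding N_def using assms(6,7) UV card by (simp add: card_index_distinct)
  have "N = m + n"
    using card UV assms(6,7) finite_verts unfolding N_def
    by (metis card_Un_disjoint distinct_card finite_Un)
  have deg: "out_degree G v = (if v \<in> U then n else m)" if "v \<in> U \<union> V" for v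
  proof -
    have "{w. v \<rightarrow>\<^bsub>G\<^esub> w} = (if v \<in> U then V else U)"
      using that UV unfolding ends by auto
    then show ?thesis using card by (simp add: out_degree_eq_card_dominated)
  qed
  have A: "eso_matrix G vs = mat N N (\<lambda>(i, j). if (i \<in> P) \<noteq> (j \<in> P) then c else 0)"
    unfolding eso_matrix_def N_def[symmetric]
  proof (intro cong_mat refl)
    fix i j assume ij: "i < N" "j < N"
    have "vs ! i \<rightarrow>\<^bsub>G\<^esub> vs ! j \<longleftrightarrow> (i \<in> P) \<noteq> (j \<in> P)"
      using vs[OF ij(1)] vs[OF ij(2)] ij UV unfolding ends P_def by auto
    then show "(case (i, j) of (i, j) \<Rightarrow> if vs ! i \<rightarrow>\<^bsub>G\<^esub> vs ! j
        then (real (out_degree G (vs ! i)) + real (out_degree G (vs ! j)))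
          * sqrt ((real (out_degree G (vs ! i)))\<^sup>2 + (real (out_degree G (vs ! j)))\<^sup>2)
        else 0) = (case (i, j) of (i, j) \<Rightarrow> if (i \<in> P) \<noteq> (j \<in> P) then c else 0)"
      using deg[OF vs[OF ij(1)]] deg[OF vs[OF ij(2)]] ij by (auto simp: P_def c_def add.commute)
  qed
  have c2: "real m * real n * c\<^sup>2 =
      real m * real n * ((real m)\<^sup>2 + (real n)\<^sup>2) * (real m + real n)\<^sup>2"
    by (simp add: c_def power_mult_distrib)
  have s2: "s\<^sup>2 = real m * real n * ((real m)\<^sup>2 + (real n)\<^sup>2) * (real m + real n)\<^sup>2"
    by (simp add: s_def power_mult_distrib)
  have cp: "eso_char_poly G vs = [:0, 1:] ^ (m + n - 2) *
      ([:0, 1:]\<^sup>2 - [:real m * real n * ((real m)\<^sup>2 + (real n)\<^sup>2) * (real m + real n)\<^sup>2:])"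
    unfolding eso_char_poly_def A c2[symmetric]
    using char_poly_bipartite_constant[of P N Q c] cP cQ \<open>N = m + n\<close> assms(1,2)
    by (auto simp: P_def Q_def)
  have "s > 0"
    unfolding s_def using assms(1,2) by (intro mult_pos_pos real_sqrt_gt_zero add_pos_pos) auto
  have "eso_matrix G vs \<in> carrier_mat N N" by (simp add: A)
  then have "{x. eigenvalue (eso_matrix G vs) x} = {x. poly (eso_char_poly G vs) x = 0}"
    unfolding eso_char_poly_def by (simp only: eigenvalue_root_char_poly)
  then have "eso_energy G vs =
      (\<Sum>x | poly (eso_char_poly G vs) x = 0. real (order x (eso_char_poly G vs)) * \<bar>x\<bar>)"
    unfolding eso_energy_def by simp
  also have "\<dots> = 2 * s"
    by (rule sum_order_abs_roots[OF \<open>s > 0\<close> cp[folded s2]])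
  finally show ?thesis using cp by (simp add: s_def)
qed

end
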